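(* Consider the limiting higher-order Maxwell--Stefan system, for $1\le i\le S$, $$\begin{cases}\partial_t\rho^i+\sum_{k=1}^3\partial_{x_k}(\rho^iu^i_k)=0,\\[2pt]\partial_{x_\ell}\big(p^i_{\ell\ell}\big)=\sum_{j=1}^S\dfrac{2\pi\|b^{ij}\|_{L^1}}{m_i+m_j}\rho^i\rho^j(u^j_\ell-u^i_\ell),&1\le\ell\le3,\\[2pt]p^i_{\langle k\ell\rangle}=0,&1\le k\ne\ell\le3,\\[2pt]p^i_{\langle\ell\ell\rangle}=-[M^{-1}\beta^{\ell\ell}]_i,&1\le\ell\le3,\end{cases}$$ where $M$, $\beta^{\ell\ell}$ and the notation are given in the context and the partial pressures $p^i$ are given by an equation of state. In order for this system to have a solution, the equation of state giving the pressures $p^i$ has to satisfy the compatibility condition: there is a function $\theta(t,x)$, independent of $i$, such that $$m_i\frac{p^i}{\rho^i}=\theta(t,x),\qquad 1\le i\le S.$$ This condition is in particular satisfied by the scaled ideal gas law $$p^i(t,x)=\frac53\,\rho^i(t,x)\,\frac{T(t,x)}{m_i},$$ where $T$ is the common temperature of the species.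
   Context: There are $S$ species with masses $m_i>0$, mass densities $\rho^i(t,x)>0$, velocities $u^i(t,x)=(u^i_1,u^i_2,u^i_3)$ and pressure tensors $p^i_{k\ell}=p^i\delta_{k\ell}+p^i_{\langle k\ell\rangle}$, where $p^i=\frac13\sum_kp^i_{kk}$ is the partial pressure and $p^i_{\langle k\ell\rangle}$ is the deviatoric part, i.e. $\sum_{k=1}^3p^i_{\langle kk\rangle}=0$ (this is part of the requirements on a solution). The $b^{ij}=b^{ji}:[-1,1]\to[0,\infty)$ are even integrable functions, not identically zero (a.e.), with $$\|b^{ij}\|_{L^1}=\int_{-1}^1b^{ij}(\eta)\,d\eta,\qquad B^{ij}=\int_{-1}^1\eta^2b^{ij}(\eta)\,d\eta .$$ $M$ is the $S\times S$ (invertible) matrix with $$M_{ij}=\frac{2\pi\|b^{ij}\|_{L^1}}{(m_i+m_j)^2}m_j\rho^i\ (j\ne i),\qquad M_{ii}=\frac{2\pi\|b^{ii}\|_{L^1}}{4m_i^2}m_i\rho^i-\sum_{j=1}^S\frac{2\pi\|b^{ij}\|_{L^1}}{(m_i+m_j)^2}(2m_i+m_j)\rho^j .$$ The vectors $\beta^{\ell\ell}\in\mathbb{R}^S$ are, for $\ell=1,2$, $$\beta^{\ell\ell}_i=\sum_{j=1}^S\frac{\pi}{(m_i+m_j)^2}\Big[\|b^{ij}\|_{L^1}\big((m_j-4m_i)\rho^jp^i+5m_j\rho^ip^j\big)-3m_jB^{ij}\big(\rho^jp^i+\rho^ip^j\big)\Big],$$ and, for $\ell=3$, $$\beta^{33}_i=\sum_{j=1}^S\frac{2\pi}{(m_i+m_j)^2}\Big[\|b^{ij}\|_{L^1}\big(-(2m_i+m_j)\rho^jp^i+m_j\rho^ip^j\big)+3m_jB^{ij}\big(\rho^jp^i+\rho^ip^j\big)\Big].$$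 $[\,\cdot\,]_i$ denotes the $i$-th component; there is no summation over $\ell$. *)

theory Defs
  imports "HOL-Analysis.Analysis"
begin

text \<open>
  The species are indexed by a finite type \<^typ>\<open>'s\<close>, and fields are functions of \<open>t\<close> and
  \<open>x\<close>. In the type \<open>3\<close> the elements \<open>1\<close>, \<open>2\<close>, \<open>3\<close> are distinct, so
  they serve as the spatial indices.
\<close>

definition kernel_L1 :: "(real \<Rightarrow> real) \<Rightarrow> real" where
  "kernel_L1 f = (LINT \<eta>:{-1..1}|lebesgue. f \<eta>)"

definition kernel_B :: "(real \<Rightarrow> real) \<Rightarrow> real" where
  "kernel_B f = (LINT \<eta>:{-1..1}|lebesgue. \<eta>\<^sup>2 * f \<eta>)"

text \<open>The kernels are total functions here; only their values on \<open>[-1, 1]\<close> matter.\<close>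

definition admissible_kernels :: "('s \<Rightarrow> 's \<Rightarrow> real \<Rightarrow> real) \<Rightarrow> bool" where
  "admissible_kernels b \<longleftrightarrow>
    (\<forall>i j. (\<forall>\<eta>\<in>{-1..1}. b i j \<eta> = b j i \<eta> \<and> 0 \<le> b i j \<eta> \<and> b i j (- \<eta>) = b i j \<eta>) \<and>
      b i j absolutely_integrable_on {-1..1} \<and>
      \<not> (AE \<eta> in lebesgue. \<eta> \<in> {-1..1} \<longrightarrow> b i j \<eta> = 0))"

definition partial_pressure :: "real^3^3 \<Rightarrow> real" where
  "partial_pressure A = (1/3) * (\<Sum>k\<in>UNIV. A $ k $ k)"

definition deviator :: "real^3^3 \<Rightarrow> real^3^3" where
  "deviator A = (\<chi> k l. A $ k $ l - (if k = l then partial_pressure A else 0))"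

text \<open>
  Every solution below meets the requirement that the deviatoric part be trace-free, because
  it is defined from the whole pressure tensor.
\<close>

lemma deviator_trace: "(\<Sum>k\<in>UNIV. deviator A $ k $ k) = 0"
  by (simp add: deviator_def partial_pressure_def sum_subtractf)

definition M_matrix ::
  "('s::finite \<Rightarrow> real) \<Rightarrow> ('s \<Rightarrow> 's \<Rightarrow> real \<Rightarrow> real) \<Rightarrow> ('s \<Rightarrow> real) \<Rightarrow> real^'s^'s" where
  "M_matrix m b r = (\<chi> i j.
    if j = i
    then 2 * pi * kernel_L1 (b i i) / (4 * (m i)\<^sup>2) * m i * r i
      - (\<Sum>k\<in>UNIV. 2 * pi * kernel_L1 (b i k) / (m i + m k)\<^sup>2 * (2 * m i + m k) * r k)
    else 2 * pi * kernel_L1 (b i j) / (m i + m j)\<^sup>2 * m j * r i)"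

definition beta_vec ::
  "('s::finite \<Rightarrow> real) \<Rightarrow> ('s \<Rightarrow> 's \<Rightarrow> real \<Rightarrow> real) \<Rightarrow> ('s \<Rightarrow> real) \<Rightarrow> ('s \<Rightarrow> real) \<Rightarrow> 3 \<Rightarrow> real^'s"
  where
  "beta_vec m b r p l = (\<chi> i.
    if l = 3
    then (\<Sum>j\<in>UNIV. 2 * pi / (m i + m j)\<^sup>2 *
      (kernel_L1 (b i j) * (- (2 * m i + m j) * r j * p i + m j * r i * p j)
        + 3 * m j * kernel_B (b i j) * (r j * p i + r i * p j)))
    else (\<Sum>j\<in>UNIV. pi / (m i + m j)\<^sup>2 *
      (kernel_L1 (b i j) * ((m j - 4 * m i) * r j * p i + 5 * m j * r i * p j)
        - 3 * m j * kernel_B (b i j) * (r j * p i + r i * p j))))"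

definition along :: "3 \<Rightarrow> (real^3 \<Rightarrow> real) \<Rightarrow> real^3 \<Rightarrow> real \<Rightarrow> real" where
  "along k f x s = f (x + s *\<^sub>R axis k 1)"

definition has_partial :: "3 \<Rightarrow> (real^3 \<Rightarrow> real) \<Rightarrow> real^3 \<Rightarrow> bool" where
  "has_partial k f x \<longleftrightarrow> along k f x differentiable (at 0)"

definition partial :: "3 \<Rightarrow> (real^3 \<Rightarrow> real) \<Rightarrow> real^3 \<Rightarrow> real" where
  "partial k f x = deriv (along k f x) 0"

text \<open>
  An equation of state \<open>E\<close> gives the partial pressures from the densities at a point and
  the further state variables \<open>w\<close> there, of arbitrary type (for instance a common temperature).
  Solutions are classical: the partial derivatives occurring in the system exist, with no
  further regularity required.
\<close>

definition maxwell_stefan_solution ::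
  "(real \<times> (real^3)) set \<Rightarrow> ('s::finite \<Rightarrow> real) \<Rightarrow> ('s \<Rightarrow> 's \<Rightarrow> real \<Rightarrow> real) \<Rightarrow>
   (('s \<Rightarrow> real) \<Rightarrow> 'w \<Rightarrow> 's \<Rightarrow> real) \<Rightarrow> (real \<Rightarrow> real^3 \<Rightarrow> 'w) \<Rightarrow>
   ('s \<Rightarrow> real \<Rightarrow> real^3 \<Rightarrow> real) \<Rightarrow> ('s \<Rightarrow> real \<Rightarrow> real^3 \<Rightarrow> real^3) \<Rightarrow>
   ('s \<Rightarrow> real \<Rightarrow> real^3 \<Rightarrow> real^3^3) \<Rightarrow> bool" where
  "maxwell_stefan_solution D m b E w \<rho> u P \<longleftrightarrow>
    (\<forall>(t, x)\<in>D. \<forall>i.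
      \<rho> i t x > 0 \<and>
      partial_pressure (P i t x) = E (\<lambda>j. \<rho> j t x) (w t x) i \<and>
      (\<lambda>s. \<rho> i s x) differentiable (at t) \<and>
      (\<forall>k. has_partial k (\<lambda>y. \<rho> i t y * u i t y $ k) x) \<and>
      deriv (\<lambda>s. \<rho> i s x) t + (\<Sum>k\<in>UNIV. partial k (\<lambda>y. \<rho> i t y * u i t y $ k) x) = 0 \<and>
      (\<forall>l. has_partial l (\<lambda>y. P i t y $ l $ l) x \<and>
        partial l (\<lambda>y. P i t y $ l $ l) x =
          (\<Sum>j\<in>UNIV. 2 * pi * kernel_L1 (b i j) / (m i + m j) * \<rho> i t x * \<rho> j t x
            * (u j t x $ l - u i t x $ l))) \<and>
      (\<forall>k l. k \<noteq> l \<longrightarrow> deviator (P i t x) $ k $ l = 0) \<and>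
      (\<forall>l. deviator (P i t x) $ l $ l =
        - ((matrix_inv (M_matrix m b (\<lambda>j. \<rho> j t x)) *v
            beta_vec m b (\<lambda>j. \<rho> j t x) (\<lambda>j. partial_pressure (P j t x)) l) $ i)))"

definition compatible_pressures ::
  "(real \<times> (real^3)) set \<Rightarrow> ('s \<Rightarrow> real) \<Rightarrow> ('s \<Rightarrow> real \<Rightarrow> real^3 \<Rightarrow> real) \<Rightarrow>
   ('s \<Rightarrow> real \<Rightarrow> real^3 \<Rightarrow> real) \<Rightarrow> bool" where
  "compatible_pressures D m \<rho> p \<longleftrightarrow>
    (\<exists>\<theta>. \<forall>(t, x)\<in>D. \<forall>i. m i * (p i t x / \<rho> i t x) = \<theta> t x)"

definition ideal_gas_law :: "('s \<Rightarrow> real) \<Rightarrow> ('s \<Rightarrow> real) \<Rightarrow> real \<Rightarrow> 's \<Rightarrow> real" where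
  "ideal_gas_law m r T i = 5/3 * r i * (T / m i)"

end

theory Submission
  imports Defs
begin

text \<open>
  The compatibility condition comes from the trace of the deviatoric stresses. For a solution
  the three vectors \<open>M\<^sup>-\<^sup>1 \<beta>\<^sup>l\<^sup>l\<close> are minus the diagonal deviators, which add up to zero, so
  \<open>M\<^sup>-\<^sup>1 (\<beta>\<^sup>1\<^sup>1 + \<beta>\<^sup>2\<^sup>2 + \<beta>\<^sup>3\<^sup>3) = 0\<close>, and since \<open>M\<close> is invertible the sum of the \<open>\<beta>\<close> vectors
  vanishes. In that sum the second moments \<open>B\<^sup>i\<^sup>j\<close> cancel, and with \<open>\<theta>\<^sub>i = m\<^sub>i p\<^sup>i / \<rho>\<^sup>i\<close> what
  remains is a weighted graph Laplacian on the complete graph of species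
  (\<open>sum_beta_vec_eq_laplacian\<close>):
  its \<open>i\<close>-th component is \<open>\<Sum>\<^sub>j c\<^sub>i\<^sub>j (\<theta>\<^sub>j - \<theta>\<^sub>i)\<close>, where \<open>c\<^sub>i\<^sub>j > 0\<close> because a
  nonnegative kernel that is not almost everywhere zero has a positive integral. By the maximum
  principle the only functions killed by such a Laplacian are the constants, so \<open>\<theta>\<^sub>i\<close> does not
  depend on \<open>i\<close>.

  Invertibility of \<open>M\<close> rests on the maximum principle as well: after substituting
  \<open>v\<^sub>j = \<rho>\<^sup>j w\<^sub>j\<close>, the equation \<open>M v = 0\<close> says that a weighted Laplacian of \<open>w\<close> equals a positive
  multiple of \<open>w\<close>, which forces \<open>w = 0\<close>.

  For the ideal gas law every \<open>\<theta>\<^sub>i\<close> equals \<open>5 T / 3\<close>.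
\<close>

section \<open>Maximum principle for weighted Laplacians\<close>

lemma finite_type_argmax:
  fixes w :: "'s::finite \<Rightarrow> real"
  obtains i where "\<And>j. w j \<le> w i"
proof -
  have "Max (range w) \<in> range w" by (rule Max_in) auto
  then obtain i where "w i = Max (range w)" by (metis imageE)
  then have "w j \<le> w i" for j by simp
  then show thesis by (rule that)
qed

text \<open>
  At a maximum point all summands \<open>c i j * (w j - w i)\<close> are nonpositive and add up to zero, so
  each of them vanishes.
\<close>

lemma laplacian_zero_imp_constant:
  fixes w :: "'s::finite \<Rightarrow> real"
  assumes c: "\<And>i j. c i j > 0"
    and zero: "\<And>i. (\<Sum>j\<in>UNIV. c i j * (w j - w i)) = 0"
  shows "w i = w j"
proof -
  obtain k where k: "\<And>j. w j \<le> w k" by (rule finite_type_argmax[of w]) blast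
  have "(\<Sum>j\<in>UNIV. c k j * (w k - w j)) = - (\<Sum>j\<in>UNIV. c k j * (w j - w k))"
    by (simp add: sum_negf[symmetric] algebra_simps)
  then have "(\<Sum>j\<in>UNIV. c k j * (w k - w j)) = 0" using zero by simp
  moreover have "0 \<le> c k j * (w k - w j)" for j
    using k[of j] less_imp_le[OF c[of k j]] by simp
  ultimately have "c k j * (w k - w j) = 0" for j
    using sum_nonneg_eq_0_iff[of UNIV "\<lambda>j. c k j * (w k - w j)"] by simp
  then have "w j = w k" for j using c[of k j] by (metis eq_iff_diff_eq_0 less_irrefl mult_eq_0_iff)
  then show ?thesis by metis
qed

text \<open>
  At a maximum point the left-hand side is nonpositive, hence so is the maximum itself.
\<close>

lemma laplacian_eigenfunction_nonpos:
  fixes w :: "'s::finite \<Rightarrow> real"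
  assumes c: "\<And>i j. c i j \<ge> 0" and d: "\<And>i. d i > 0"
    and eq: "\<And>i. (\<Sum>j\<in>UNIV. c i j * (w j - w i)) = d i * w i"
  shows "w i \<le> 0"
proof -
  obtain k where k: "\<And>j. w j \<le> w k" by (rule finite_type_argmax[of w]) blast
  have "(\<Sum>j\<in>UNIV. c k j * (w j - w k)) \<le> 0"
    using k c by (intro sum_nonpos) (simp add: mult_nonneg_nonpos)
  then have "w k \<le> 0" using d[of k] eq[of k] by (simp add: mult_le_0_iff)
  then show ?thesis using k[of i] by linarith
qed

lemma laplacian_eigenfunction_zero:
  fixes w :: "'s::finite \<Rightarrow> real"
  assumes c: "\<And>i j. c i j \<ge> 0" and d: "\<And>i. d i > 0"
    and eq: "\<And>i. (\<Sum>j\<in>UNIV. c i j * (w j - w i)) = d i * w i"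
  shows "w i = 0"
proof (rule antisym)
  show "w i \<le> 0" using c d eq by (rule laplacian_eigenfunction_nonpos)
  have "(\<Sum>j\<in>UNIV. c i j * (- w j - - w i)) = - (\<Sum>j\<in>UNIV. c i j * (w j - w i))" for i
    by (simp add: sum_negf[symmetric] algebra_simps)
  then have "(\<Sum>j\<in>UNIV. c i j * (- w j - - w i)) = d i * - w i" for i
    by (simp only: eq mult_minus_right)
  with c d have "- w i \<le> 0" by (rule laplacian_eigenfunction_nonpos[where w = "\<lambda>j. - w j"])
  then show "0 \<le> w i" by simp
qed

section \<open>Collision kernels and the matrix of the stress relations\<close>

lemma kernel_L1_pos:
  assumes "admissible_kernels b"
  shows "kernel_L1 (b i j) > 0"
proof -
  let ?f = "\<lambda>\<eta>. indicat_real {-1..1} \<eta> *\<^sub>R b i j \<eta>"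
  have int: "integrable lebesgue ?f"
    and nz: "\<not> (AE \<eta> in lebesgue. \<eta> \<in> {-1..1} \<longrightarrow> b i j \<eta> = 0)"
    and nn: "\<And>\<eta>. \<eta> \<in> {-1..1} \<Longrightarrow> 0 \<le> b i j \<eta>"
    using assms unfolding admissible_kernels_def set_integrable_def by blast+
  have pos: "0 \<le> ?f \<eta>" for \<eta> using nn[of \<eta>] by (auto simp: indicator_def)
  have "(AE \<eta> in lebesgue. ?f \<eta> = 0) \<longleftrightarrow> (AE \<eta> in lebesgue. \<eta> \<in> {-1..1} \<longrightarrow> b i j \<eta> = 0)"
    by (rule AE_cong) (auto simp: indicator_def)
  then have "integral\<^sup>L lebesgue ?f \<noteq> 0"
    using nz integral_nonneg_eq_0_iff_AE[OF int] pos by simp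
  moreover have "integral\<^sup>L lebesgue ?f \<ge> 0" using pos by simp
  ultimately show ?thesis by (simp add: kernel_L1_def set_lebesgue_integral_def)
qed

text \<open>
  Absorbing the factor \<open>r j\<close> into the unknown turns \<open>M\<close>, up to the row factor \<open>r i\<close>, into a
  Laplacian minus a positive diagonal: the coefficient \<open>2 * m i + m k\<close> on the diagonal splits into \<open>m k\<close>, which balances
  the row, and the surplus \<open>2 * m i\<close>.
\<close>

lemma M_matrix_mult_eq_laplacian:
  fixes m r w :: "'s::finite \<Rightarrow> real"
  shows "(M_matrix m b r *v (\<chi> j. r j * w j)) $ i =
    r i * ((\<Sum>j\<in>UNIV. 2 * pi * kernel_L1 (b i j) / (m i + m j)\<^sup>2 * r j * m j * (w j - w i))
      - (\<Sum>j\<in>UNIV. 2 * pi * kernel_L1 (b i j) / (m i + m j)\<^sup>2 * r j * (2 * m i)) * w i)"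
proof -
  define a where "a j = 2 * pi * kernel_L1 (b i j) / (m i + m j)\<^sup>2" for j
  define S where "S = (\<Sum>k\<in>UNIV. a k * (2 * m i + m k) * r k)"
  have "(m i + m i)\<^sup>2 = 4 * (m i)\<^sup>2" by (simp add: power2_eq_square)
  then have entry: "M_matrix m b r $ i $ j = a j * m j * r i - (if j = i then S else 0)" for j
    by (simp add: M_matrix_def a_def S_def)
  have "(M_matrix m b r *v (\<chi> j. r j * w j)) $ i =
      (\<Sum>j\<in>UNIV. a j * m j * r i * (r j * w j) - (if j = i then S * (r j * w j) else 0))"
    unfolding matrix_vector_mult_def vec_lambda_beta
    by (intro sum.cong refl) (auto simp: entry left_diff_distrib)
  also have "\<dots> = (\<Sum>j\<in>UNIV. a j * m j * r i * (r j * w j)) - S * (r i * w i)"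
    by (simp add: sum_subtractf)
  also have "\<dots> = r i * ((\<Sum>j\<in>UNIV. a j * r j * m j * (w j - w i))
      - (\<Sum>j\<in>UNIV. a j * r j * (2 * m i)) * w i)"
    unfolding S_def
    by (simp add: sum_distrib_left sum_distrib_right sum_subtractf[symmetric] algebra_simps
        sum.distrib[symmetric])
  finally show ?thesis unfolding a_def .
qed

lemma invertible_M_matrix:
  fixes m r :: "'s::finite \<Rightarrow> real"
  assumes m: "\<And>i. m i > 0" and L1: "\<And>i j. kernel_L1 (b i j) > 0" and r: "\<And>i. r i > 0"
  shows "invertible (M_matrix m b r)"
proof -
  define c where "c i j = 2 * pi * kernel_L1 (b i j) / (m i + m j)\<^sup>2 * r j" for i j
  have c: "c i j > 0" for i j
    using L1[of i j] r[of j] add_pos_pos[OF m[of i] m[of j]] by (simp add: c_def)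
  have "v = 0" if v: "M_matrix m b r *v v = 0" for v
  proof -
    define w where "w j = v $ j / r j" for j
    have vw: "v = (\<chi> j. r j * w j)" using r by (simp add: vec_eq_iff w_def less_imp_neq[THEN not_sym])
    have "w i = 0" for i
    proof (rule laplacian_eigenfunction_zero[where c = "\<lambda>i j. c i j * m j"
          and d = "\<lambda>i. \<Sum>j\<in>UNIV. c i j * (2 * m i)"])
      show "c i j * m j \<ge> 0" for i j using c[of i j] m[of j] by simp
      show "(\<Sum>j\<in>UNIV. c i j * (2 * m i)) > 0" for i
        using c m by (intro sum_pos) auto
      show "(\<Sum>j\<in>UNIV. c i j * m j * (w j - w i)) = (\<Sum>j\<in>UNIV. c i j * (2 * m i)) * w i" for i
        using M_matrix_mult_eq_laplacian[of m b r w i] v r[of i] unfolding vw c_def by simp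
    qed
    then show "v = 0" by (simp add: vw vec_eq_iff)
  qed
  then show ?thesis
    by (auto simp: invertible_left_inverse matrix_left_invertible_ker)
qed

section \<open>The compatibility condition\<close>

text \<open>
  Relative to the common prefactor \<open>pi / (m i + m j)\<^sup>2\<close>, the terms with \<open>kernel_B\<close> carry the
  factors \<open>-3\<close>, \<open>-3\<close> and \<open>6\<close> and cancel; the same count leaves
  \<open>12 * (m j * r i * p j - m i * r j * p i)\<close> next to \<open>kernel_L1\<close>, and dividing by \<open>r i * r j\<close>
  turns this bracket into a difference of the ratios \<open>m j * (p j / r j)\<close>.
\<close>

lemma sum_beta_vec_eq_laplacian:
  fixes m r p :: "'s::finite \<Rightarrow> real"
  assumes r: "\<And>i. r i > 0"
  shows "(\<Sum>l\<in>UNIV. beta_vec m b r p l) $ i =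
    (\<Sum>j\<in>UNIV. 12 * pi * kernel_L1 (b i j) * r i * r j / (m i + m j)\<^sup>2
      * (m j * (p j / r j) - m i * (p i / r i)))"
proof -
  define \<theta> where "\<theta> j = m j * (p j / r j)" for j
  have mp: "m j * p j = \<theta> j * r j" for j using r[of j] by (simp add: \<theta>_def)
  define f where "f j = pi / (m i + m j)\<^sup>2 *
      (kernel_L1 (b i j) * ((m j - 4 * m i) * r j * p i + 5 * m j * r i * p j)
        - 3 * m j * kernel_B (b i j) * (r j * p i + r i * p j))" for j
  define g where "g j = 2 * pi / (m i + m j)\<^sup>2 *
      (kernel_L1 (b i j) * (- (2 * m i + m j) * r j * p i + m j * r i * p j)
        + 3 * m j * kernel_B (b i j) * (r j * p i + r i * p j))" for j
  have "beta_vec m b r p l $ i = (if l = 3 then sum g UNIV else sum f UNIV)" for l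
    unfolding beta_vec_def f_def g_def by simp
  then have "(\<Sum>l\<in>UNIV. beta_vec m b r p l) $ i = (\<Sum>j\<in>UNIV. f j + f j + g j)"
    by (simp add: sum_3 sum.distrib sum_distrib_left[symmetric])
  also have "\<dots> = (\<Sum>j\<in>UNIV. 12 * pi * kernel_L1 (b i j) / (m i + m j)\<^sup>2
      * (r i * (m j * p j) - r j * (m i * p i)))"
    by (intro sum.cong refl) (simp add: f_def g_def divide_inverse algebra_simps)
  also have "\<dots> = (\<Sum>j\<in>UNIV. 12 * pi * kernel_L1 (b i j) * r i * r j / (m i + m j)\<^sup>2 * (\<theta> j - \<theta> i))"
    by (intro sum.cong refl) (simp add: mp divide_inverse algebra_simps)
  finally show ?thesis unfolding \<theta>_def .
qed

text \<open>
  The compatibility condition is a pointwise, purely algebraic consequence of the stress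
  relations: multiplying the trace condition by \<open>M\<close> removes the inverse matrix, and what is left
  is a vanishing Laplacian.
\<close>

lemma trace_free_stresses_imp_equal_ratios:
  fixes m r p :: "'s::finite \<Rightarrow> real"
  assumes m: "\<And>i. m i > 0" and L1: "\<And>i j. kernel_L1 (b i j) > 0" and r: "\<And>i. r i > 0"
    and trace: "\<And>i. (\<Sum>l\<in>UNIV. (matrix_inv (M_matrix m b r) *v beta_vec m b r p l) $ i) = 0"
  shows "m i * (p i / r i) = m j * (p j / r j)"
proof -
  let ?M = "M_matrix m b r" and ?\<beta> = "\<Sum>l\<in>UNIV. beta_vec m b r p l"
  have "matrix_inv ?M *v ?\<beta> = (\<Sum>l\<in>UNIV. matrix_inv ?M *v beta_vec m b r p l)"
    by (rule linear_sum) (rule matrix_vector_mul_linear)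
  also have "\<dots> = 0" using trace by (simp add: vec_eq_iff)
  finally have "matrix_inv ?M *v ?\<beta> = 0" .
  moreover have "invertible ?M" using m L1 r by (rule invertible_M_matrix)
  then have "?M ** matrix_inv ?M = mat 1"
    unfolding invertible_def matrix_inv_def by (rule someI2_ex) simp
  then have "?\<beta> = ?M *v (matrix_inv ?M *v ?\<beta>)"
    by (simp add: matrix_vector_mul_assoc)
  ultimately have "?\<beta> = 0" by simp
  then have "(\<Sum>j\<in>UNIV. 12 * pi * kernel_L1 (b i j) * r i * r j / (m i + m j)\<^sup>2
      * (m j * (p j / r j) - m i * (p i / r i))) = 0" for i
    using sum_beta_vec_eq_laplacian[where m = m and b = b and r = r and p = p and i = i] r
    by (simp only: zero_index)
  moreover have "12 * pi * kernel_L1 (b i j) * r i * r j / (m i + m j)\<^sup>2 > 0" for i j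
    using L1[of i j] r[of i] r[of j] add_pos_pos[OF m[of i] m[of j]] by simp
  ultimately show ?thesis
    by (intro laplacian_zero_imp_constant
        [where w = "\<lambda>j. m j * (p j / r j)"
          and c = "\<lambda>i j. 12 * pi * kernel_L1 (b i j) * r i * r j / (m i + m j)\<^sup>2"])
qed

lemma compatible_pressuresI:
  fixes m :: "'s \<Rightarrow> real"
  assumes "\<And>t x i j. (t, x) \<in> D \<Longrightarrow> m i * (p i t x / \<rho> i t x) = m j * (p j t x / \<rho> j t x)"
  shows "compatible_pressures D m \<rho> p"
  unfolding compatible_pressures_def
  \<comment> \<open>any fixed species provides the common value\<close>
  using assms by (intro exI[of _ "\<lambda>t x. m undefined * (p undefined t x / \<rho> undefined t x)"]) blast

theorem proposition7:
  fixes m :: "'s::finite \<Rightarrow> real"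
    and b :: "'s \<Rightarrow> 's \<Rightarrow> real \<Rightarrow> real"
    and D :: "(real \<times> (real^3)) set"
    and E :: "('s \<Rightarrow> real) \<Rightarrow> 'w \<Rightarrow> 's \<Rightarrow> real"
  assumes "\<And>i. m i > 0"
    and "admissible_kernels b"
    and "open D"
  shows "(\<forall>w \<rho> u P. maxwell_stefan_solution D m b E w \<rho> u P \<longrightarrow>
            compatible_pressures D m \<rho> (\<lambda>i t x. E (\<lambda>j. \<rho> j t x) (w t x) i)) \<and>
         (\<forall>\<rho> T. (\<forall>(t, x)\<in>D. \<forall>i. \<rho> i t x > 0) \<longrightarrow>
            compatible_pressures D m \<rho> (\<lambda>i t x. ideal_gas_law m (\<lambda>j. \<rho> j t x) (T t x) i))"
proof (intro conjI allI impI)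
  fix w \<rho> u P
  assume sol: "maxwell_stefan_solution D m b E w \<rho> u P"
  show "compatible_pressures D m \<rho> (\<lambda>i t x. E (\<lambda>j. \<rho> j t x) (w t x) i)"
  proof (rule compatible_pressuresI)
    fix t x i j
    assume "(t, x) \<in> D"
    with sol have pos: "\<And>i. \<rho> i t x > 0"
      and state: "\<And>i. partial_pressure (P i t x) = E (\<lambda>j. \<rho> j t x) (w t x) i"
      and stress: "\<And>i l. deviator (P i t x) $ l $ l =
        - ((matrix_inv (M_matrix m b (\<lambda>j. \<rho> j t x)) *v
            beta_vec m b (\<lambda>j. \<rho> j t x) (\<lambda>j. partial_pressure (P j t x)) l) $ i)"
      unfolding maxwell_stefan_solution_def by blast+
    have "(\<Sum>l\<in>UNIV. (matrix_inv (M_matrix m b (\<lambda>j. \<rho> j t x)) *v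
        beta_vec m b (\<lambda>j. \<rho> j t x) (\<lambda>j. partial_pressure (P j t x)) l) $ i) = 0" for i
      using deviator_trace[of "P i t x"] by (simp add: stress sum_negf)
    with assms(1) kernel_L1_pos[OF assms(2)] pos
    have "m i * (partial_pressure (P i t x) / \<rho> i t x) =
        m j * (partial_pressure (P j t x) / \<rho> j t x)"
      by (rule trace_free_stresses_imp_equal_ratios)
    then show "m i * (E (\<lambda>j. \<rho> j t x) (w t x) i / \<rho> i t x) =
        m j * (E (\<lambda>j. \<rho> j t x) (w t x) j / \<rho> j t x)"
      by (simp add: state)
  qed
next
  fix \<rho> :: "'s \<Rightarrow> real \<Rightarrow> real^3 \<Rightarrow> real" and T :: "real \<Rightarrow> real^3 \<Rightarrow> real"
  assume pos: "\<forall>(t, x)\<in>D. \<forall>i. \<rho> i t x > 0"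
  show "compatible_pressures D m \<rho> (\<lambda>i t x. ideal_gas_law m (\<lambda>j. \<rho> j t x) (T t x) i)"
  proof (rule compatible_pressuresI)
    fix t x i j
    assume "(t, x) \<in> D"
    with pos have "\<rho> k t x \<noteq> 0" for k by (metis (mono_tags, lifting) case_prodD less_irrefl)
    moreover have "m k \<noteq> 0" for k using assms(1)[of k] by simp
    ultimately have "m k * (ideal_gas_law m (\<lambda>j. \<rho> j t x) (T t x) k / \<rho> k t x) = 5/3 * T t x" for k
      by (simp add: ideal_gas_law_def)
    then show "m i * (ideal_gas_law m (\<lambda>j. \<rho> j t x) (T t x) i / \<rho> i t x) =
        m j * (ideal_gas_law m (\<lambda>j. \<rho> j t x) (T t x) j / \<rho> j t x)"
      by metis
  qed
qed

end
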